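(* Let $G$ be a group and $S$ a submonoid of $G$. Then there exist a topological space $X$ and a subgroup $A(X)$ of $\mathcal{B}(X)$ such that the pair $(G,S)$ is isomorphic to the pair $(A(X),\mathcal{C}(A(X)))$.
   Context: A subset $S$ of a group $G$ with unit element $e$ is called a submonoid of $G$ if (1) $e\in S$, and (2) whenever $a,b\in S$, also $ab\in S$. For a topological space $X$, $\mathcal{B}(X)$ denotes the group of all bijections from $X$ to $X$ (not necessarily continuous) under composition of maps. For a subgroup $A(X)$ of $\mathcal{B}(X)$, $\mathcal{C}(A(X))$ denotes the set of all elements of $A(X)$ that are continuous as maps $X\to X$; it is a submonoid of $A(X)$. Given groups $G,H$ and submonoids $S\subseteq G$, $T\subseteq H$, the pair $(G,S)$ is said to be isomorphic to the pair $(H,T)$ if there is a group isomorphism $h:G\to H$ such that $h(S)=T$. *)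

theory Defs
  imports "HOL-Analysis.Abstract_Topology" "HOL-Algebra.Bij"
begin

text \<open>The pairs \<open>(G, S)\<close> and \<open>(H, T)\<close> are meant to consist of a group and a submonoid of it.\<close>

definition pair_isomorphic ::
    "('a, 'm) monoid_scheme \<Rightarrow> 'a set \<Rightarrow> ('b, 'n) monoid_scheme \<Rightarrow> 'b set \<Rightarrow> bool" where
  "pair_isomorphic G S H T \<longleftrightarrow> (\<exists>h \<in> iso G H. h ` S = T)"

text \<open>
  The group of all bijections of a space \<open>X\<close> is \<open>BijGroup (topspace X)\<close>. Its elements are the
  extensional functions that map \<open>topspace X\<close> bijectively to itself; a subgroup \<open>A\<close>
  of it is regarded as a group by restricting the carrier to \<open>A\<close>.
\<close>

abbreviation bijection_subgroup :: "'a topology \<Rightarrow> ('a \<Rightarrow> 'a) set \<Rightarrow> ('a \<Rightarrow> 'a) monoid" where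
  "bijection_subgroup X A \<equiv> (BijGroup (topspace X))\<lparr>carrier := A\<rparr>"

definition continuous_elements :: "'a topology \<Rightarrow> ('a \<Rightarrow> 'a) set \<Rightarrow> ('a \<Rightarrow> 'a) set" where
  "continuous_elements X A = {f \<in> A. continuous_map X X f}"

lemma submonoid_continuous_elements:
  assumes "subgroup A (BijGroup (topspace X))"
  shows "submonoid (continuous_elements X A) (bijection_subgroup X A)"
proof
  interpret subgroup A "BijGroup (topspace X)" by fact
  have Bij: "f \<in> Bij (topspace X)" if "f \<in> A" for f
    using that subset by (auto simp: BijGroup_def)
  show "continuous_elements X A \<subseteq> carrier (bijection_subgroup X A)"
    by (auto simp: continuous_elements_def)
  have "continuous_map X X \<one>\<^bsub>BijGroup (topspace X)\<^esub>"
    by (rule continuous_map_eq[OF continuous_map_id]) (simp add: BijGroup_def)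
  then show "\<one>\<^bsub>bijection_subgroup X A\<^esub> \<in> continuous_elements X A"
    using one_closed by (simp add: continuous_elements_def)
  fix f g assume "f \<in> continuous_elements X A" "g \<in> continuous_elements X A"
  then have f: "f \<in> A" "continuous_map X X f" and g: "g \<in> A" "continuous_map X X g"
    by (auto simp: continuous_elements_def)
  have "continuous_map X X (f \<otimes>\<^bsub>BijGroup (topspace X)\<^esub> g)"
    by (rule continuous_map_eq[OF continuous_map_compose[OF g(2) f(2)]])
      (use Bij f g in \<open>simp add: BijGroup_def compose_def\<close>)
  then show "f \<otimes>\<^bsub>bijection_subgroup X A\<^esub> g \<in> continuous_elements X A"
    using m_closed f g by (simp add: continuous_elements_def)
qed

end

theory Submission
  imports Defs
begin

text \<open>
  Let \<open>G\<close> act by left translation on two disjoint copies of itself. Join the two copies of a point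
  \<open>s\<close> by an edge exactly when \<open>s \<in> S\<close>, directed from the \<open>True\<close> copy to the \<open>False\<close> copy. These
  edges form a (trivially transitive) strict order, and in the associated Alexandrov topology the
  continuous maps are those that respect the order. Translation by \<open>g\<close> moves the edge at \<open>s\<close>
  to the pair of copies of \<open>g s\<close>, so it is continuous iff \<open>g S \<subseteq> S\<close>. As \<open>S\<close> is closed under
  multiplication and contains the unit, this means \<open>g \<in> S\<close>. The action is faithful, so \<open>G\<close> is
  isomorphic to the group of translations, and the isomorphism takes \<open>S\<close> onto the continuous ones.
\<close>

definition doubled_topology :: "'a set \<Rightarrow> 'a set \<Rightarrow> ('a \<times> bool) topology" where
  "doubled_topology C S =
     topology (\<lambda>U. U \<subseteq> C \<times> UNIV \<and> (\<forall>s\<in>S. (s, True) \<in> U \<longrightarrow> (s, False) \<in> U))"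

lemma openin_doubled_topology:
  "openin (doubled_topology C S) U \<longleftrightarrow>
     U \<subseteq> C \<times> UNIV \<and> (\<forall>s\<in>S. (s, True) \<in> U \<longrightarrow> (s, False) \<in> U)"
proof -
  have "istopology (\<lambda>U. U \<subseteq> C \<times> UNIV \<and> (\<forall>s\<in>S. (s, True) \<in> U \<longrightarrow> (s, False) \<in> U))"
    unfolding istopology_def by blast
  then show ?thesis
    unfolding doubled_topology_def by (simp add: topology_inverse')
qed

lemma topspace_doubled_topology:
  assumes "S \<subseteq> C"
  shows "topspace (doubled_topology C S) = C \<times> UNIV"
proof (rule antisym)
  show "topspace (doubled_topology C S) \<subseteq> C \<times> UNIV"
    using openin_topspace openin_doubled_topology by blast
  have "openin (doubled_topology C S) (C \<times> UNIV)"
    using assms by (auto simp: openin_doubled_topology)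
  then show "C \<times> UNIV \<subseteq> topspace (doubled_topology C S)"
    by (rule openin_subset)
qed

definition doubled_translation :: "('a, 'm) monoid_scheme \<Rightarrow> 'a \<Rightarrow> 'a \<times> bool \<Rightarrow> 'a \<times> bool" where
  "doubled_translation G g = (\<lambda>p \<in> carrier G \<times> UNIV. (g \<otimes>\<^bsub>G\<^esub> fst p, snd p))"

context group
begin

lemma doubled_translation_in_Bij:
  assumes g: "g \<in> carrier G"
  shows "doubled_translation G g \<in> Bij (carrier G \<times> UNIV)"
proof -
  have "bij_betw (doubled_translation G g) (carrier G \<times> UNIV) (carrier G \<times> UNIV)"
  proof (rule bij_betwI)
    show "doubled_translation G g \<in> carrier G \<times> UNIV \<rightarrow> carrier G \<times> UNIV"
      "doubled_translation G (inv g) \<in> carrier G \<times> UNIV \<rightarrow> carrier G \<times> UNIV"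
      using g by (auto simp: doubled_translation_def)
  qed (use g in \<open>auto simp: doubled_translation_def m_assoc[symmetric]\<close>)
  then show ?thesis
    by (simp add: Bij_def doubled_translation_def)
qed

lemma doubled_translation_hom:
  "doubled_translation G \<in> hom G (BijGroup (carrier G \<times> UNIV))"
proof (rule homI)
  fix g h assume gh: "g \<in> carrier G" "h \<in> carrier G"
  have "doubled_translation G (g \<otimes> h) =
      compose (carrier G \<times> UNIV) (doubled_translation G g) (doubled_translation G h)"
    using gh by (auto simp: doubled_translation_def compose_def m_assoc fun_eq_iff)
  then show "doubled_translation G (g \<otimes> h) =
      doubled_translation G g \<otimes>\<^bsub>BijGroup (carrier G \<times> UNIV)\<^esub> doubled_translation G h"
    using gh by (simp add: BijGroup_def doubled_translation_in_Bij)
qed (simp add: BijGroup_def doubled_translation_in_Bij)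

lemma inj_on_doubled_translation: "inj_on (doubled_translation G) (carrier G)"
proof (rule inj_onI)
  fix g h assume gh: "g \<in> carrier G" "h \<in> carrier G"
    and "doubled_translation G g = doubled_translation G h"
  then have "doubled_translation G g (\<one>, True) = doubled_translation G h (\<one>, True)"
    by simp
  then show "g = h"
    using gh by (simp add: doubled_translation_def)
qed

text \<open>
  If \<open>g \<notin> S\<close>, then deleting the single point \<open>(g, False)\<close> leaves an open set, because no edge
  ends there. Its preimage contains \<open>(\<one>, True)\<close> but not \<open>(\<one>, False)\<close>, so it violates the
  condition imposed by the edge at \<open>\<one> \<in> S\<close>.
\<close>
lemma continuous_map_doubled_translation_iff:
  assumes S: "submonoid S G" and g: "g \<in> carrier G"
  shows "continuous_map (doubled_topology (carrier G) S) (doubled_topology (carrier G) S)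
           (doubled_translation G g) \<longleftrightarrow> g \<in> S"
    (is "continuous_map ?X ?X ?f \<longleftrightarrow> _")
proof -
  interpret S: submonoid S G by fact
  have top: "topspace ?X = carrier G \<times> UNIV"
    by (rule topspace_doubled_topology[OF S.subset])
  have f: "?f (x, b) = (g \<otimes> x, b)" if "x \<in> carrier G" for x b
    using that by (simp add: doubled_translation_def)
  show ?thesis
  proof
    assume cont: "continuous_map ?X ?X ?f"
    show "g \<in> S"
    proof (rule ccontr)
      assume "g \<notin> S"
      then have "openin ?X (carrier G \<times> UNIV - {(g, False)})"
        using S.subset by (auto simp: openin_doubled_topology)
      then have "openin ?X {p \<in> topspace ?X. ?f p \<in> carrier G \<times> UNIV - {(g, False)}}"
        by (rule openin_continuous_map_preimage[OF cont])
      then show False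
        using g S.one_closed by (auto simp: openin_doubled_topology top f)
    qed
  next
    assume "g \<in> S"
    show "continuous_map ?X ?X ?f"
      unfolding continuous_map_def
    proof (intro conjI allI impI)
      show "?f \<in> topspace ?X \<rightarrow> topspace ?X"
        using g by (auto simp: top f)
      fix U assume "openin ?X U"
      then show "openin ?X {p \<in> topspace ?X. ?f p \<in> U}"
        using \<open>g \<in> S\<close> S.subset by (auto simp: openin_doubled_topology top f)
    qed
  qed
qed

end

theorem theorem3p1:
  fixes G :: "('a, 'm) monoid_scheme" and S :: "'a set"
  assumes "group G" and "submonoid S G"
  shows "\<exists>(X :: ('a \<times> bool) topology) A.
           subgroup A (BijGroup (topspace X)) \<and>
           pair_isomorphic G S (bijection_subgroup X A) (continuous_elements X A)"
proof -
  interpret group G by fact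
  interpret S: submonoid S G by fact
  define X where "X = doubled_topology (carrier G) S"
  define A where "A = doubled_translation G ` carrier G"
  have top: "topspace X = carrier G \<times> UNIV"
    unfolding X_def by (rule topspace_doubled_topology[OF S.subset])
  have hom: "doubled_translation G \<in> hom G (BijGroup (topspace X))"
    unfolding top by (rule doubled_translation_hom)
  interpret \<phi>: group_hom G "BijGroup (topspace X)" "doubled_translation G"
    using hom by (intro group_hom.intro group_hom_axioms.intro group_BijGroup is_group)
  have "subgroup A (BijGroup (topspace X))"
    unfolding A_def by (rule \<phi>.img_is_subgroup)
  moreover have "doubled_translation G \<in> iso G (bijection_subgroup X A)"
    using hom inj_on_doubled_translation
    by (auto simp: iso_def hom_def bij_betw_def A_def)
  moreover have "doubled_translation G ` S = continuous_elements X A"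
    using continuous_map_doubled_translation_iff[OF \<open>submonoid S G\<close>] S.subset
    by (auto simp: continuous_elements_def A_def X_def)
  ultimately show ?thesis
    unfolding pair_isomorphic_def by blast
qed

end
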